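(* For any non-negative integer $n$, the numbers $pa(n),pb(n),pc(n),pd(n)$ of ice model configurations on the Sierpinski gasket $SG(n)$ with prescribed orientations at the outmost vertices satisfy $$pa(n+1)=[pa(n)+pb(n)]^2\,[pa(n)+3pc(n)+pd(n)],$$ $$pb(n+1)=[pa(n)+pb(n)]^2\,[pb(n)+3pc(n)+pd(n)],$$ $$pc(n+1)=pa^2(n)\,pb(n)+pb^2(n)\,pa(n)+[3pc(n)+pd(n)]^3,$$ $$pd(n+1)=pa^3(n)+pb^3(n)+[3pc(n)+pd(n)]^3 .$$
   Context: The two-dimensional Sierpinski gasket graphs $SG(n)$, $n\ge 0$, are defined recursively. $SG(0)$ is a triangle (three vertices, three edges), drawn as an equilateral triangle, with all three vertices called outmost. $SG(n+1)$ is obtained by subdividing a larger equilateral triangle into four congruent equilateral triangles, placing a copy of $SG(n)$ in each of the three corner triangles (bottom left, bottom right, top; not in the middle one), and identifying the outmost vertices of different copies that coincide (each pair of copies shares exactly one vertex). The outmost vertices of $SG(n+1)$ are the three corners of the large triangle. The three outmost vertices of $SG(n)$ have degree 2 and all others have degree 4. An ice model configuration on $SG(n)$ is an assignment of an orientation to every edge such that at every vertex of degree 4 exactly two incident edges point toward the vertex and two point away. No condition is imposed at the three outmost vertices. Denote the outmost vertices of $SG(n)$ by $L$ (bottom left), $R$ (bottom right), $T$ (top). Each outmost vertex has exactly two incident edges, one lying on each of the two sides of the big triangle meeting at that corner; sides are denoted $LT$, $TR$, $LR$. An edge at an outmost vertex is called "in" if it points toward that vertex and "out" otherwise. The following count ice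 model configurations on $SG(n)$ with prescribed boundary orientations (by the rotation and reflection symmetries of $SG(n)$, the counts do not change if the labels $L,R,T$ are permuted): - $pa(n)$: both edges at $L$ are out; both edges at $R$ are in; at $T$ the edge on $TR$ is in and the edge on $LT$ is out. - $pb(n)$: both edges at $L$ are out; both edges at $R$ are in; at $T$ the edge on $TR$ is out and the edge on $LT$ is in. - $pc(n)$: at $T$ the edge on $TR$ is in and the edge on $LT$ is out; at $R$ the edge on $TR$ is in and the edge on $LR$ is out; at $L$ the edge on $LR$ is in and the edge on $LT$ is out. - $pd(n)$: at $T$ the edge on $LT$ is in and the edge on $TR$ is out; at $R$ the edge on $TR$ is in and the edge on $LR$ is out; at $L$ the edge on $LR$ is in and the edge on $LT$ is out. Initial values: $pa(0)=pc(0)=0$, $pb(0)=pd(0)=1$. *)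

theory Defs
  imports Main "HOL-Library.Product_Plus"
begin

text \<open>
  Vertices carry lattice coordinates: the pair \<open>(x, y)\<close> stands for the point
  \<open>x u + y v\<close> of the plane, where \<open>u\<close> and \<open>v\<close> are the unit vectors along the
  bottom and the left side of the triangle. Two copies of a gasket share a vertex
  exactly when the coordinates agree, so taking unions performs the identification of
  coinciding outmost vertices.
\<close>

type_synonym point = "nat \<times> nat"

definition cornerL :: "nat \<Rightarrow> point" where "cornerL n = (0, 0)"
definition cornerR :: "nat \<Rightarrow> point" where "cornerR n = (2 ^ n, 0)"
definition cornerT :: "nat \<Rightarrow> point" where "cornerT n = (0, 2 ^ n)"

fun sg_verts :: "nat \<Rightarrow> point set" where
  "sg_verts 0 = {cornerL 0, cornerR 0, cornerT 0}"
| "sg_verts (Suc n) =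
     sg_verts n \<union> (+) (cornerR n) ` sg_verts n \<union> (+) (cornerT n) ` sg_verts n"

fun sg_edges :: "nat \<Rightarrow> point set set" where
  "sg_edges 0 =
     {{cornerL 0, cornerR 0}, {cornerR 0, cornerT 0}, {cornerL 0, cornerT 0}}"
| "sg_edges (Suc n) =
     sg_edges n \<union> (`) ((+) (cornerR n)) ` sg_edges n \<union> (`) ((+) (cornerT n)) ` sg_edges n"

definition vertex_degree :: "'a set set \<Rightarrow> 'a \<Rightarrow> nat" where
  "vertex_degree E v = card {e \<in> E. v \<in> e}"

text \<open>
  An orientation of a loop-free graph with edge set \<open>E\<close> is a set of arcs containing, for
  every edge \<open>{u, v}\<close>, exactly one of \<open>(u, v)\<close> and \<open>(v, u)\<close>, and nothing else. The arc
  \<open>(u, v)\<close> points toward \<open>v\<close>.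
\<close>

definition orientations :: "'a set set \<Rightarrow> ('a \<times> 'a) set set" where
  "orientations E = {D. (\<forall>(u, v) \<in> D. {u, v} \<in> E) \<and>
     (\<forall>u v. {u, v} \<in> E \<longrightarrow> ((u, v) \<in> D \<longleftrightarrow> (v, u) \<notin> D))}"

definition ice_configs :: "nat \<Rightarrow> (point \<times> point) set set" where
  "ice_configs n = {D \<in> orientations (sg_edges n).
     \<forall>v \<in> sg_verts n. vertex_degree (sg_edges n) v = 4 \<longrightarrow>
       card {u. (u, v) \<in> D} = 2 \<and> card {u. (v, u) \<in> D} = 2}"

definition sideLR :: "nat \<Rightarrow> point set" where "sideLR n = {(x, y). y = 0 \<and> x \<le> 2 ^ n}"
definition sideLT :: "nat \<Rightarrow> point set" where "sideLT n = {(x, y). x = 0 \<and> y \<le> 2 ^ n}"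
definition sideTR :: "nat \<Rightarrow> point set" where "sideTR n = {(x, y). x + y = 2 ^ n}"

text \<open>
  At an outmost vertex \<open>v\<close> exactly one incident edge lies on a given side \<open>S\<close> through \<open>v\<close>;
  the following predicates give the direction of that edge relative to \<open>v\<close>.
\<close>

definition edge_in :: "('a \<times> 'a) set \<Rightarrow> 'a \<Rightarrow> 'a set \<Rightarrow> bool" where
  "edge_in D v S \<longleftrightarrow> (\<exists>u \<in> S. (u, v) \<in> D)"

definition edge_out :: "('a \<times> 'a) set \<Rightarrow> 'a \<Rightarrow> 'a set \<Rightarrow> bool" where
  "edge_out D v S \<longleftrightarrow> (\<exists>u \<in> S. (v, u) \<in> D)"

definition pa :: "nat \<Rightarrow> nat" where
  "pa n = card {D \<in> ice_configs n.
     edge_out D (cornerL n) (sideLT n) \<and> edge_out D (cornerL n) (sideLR n) \<and>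
     edge_in D (cornerR n) (sideTR n) \<and> edge_in D (cornerR n) (sideLR n) \<and>
     edge_in D (cornerT n) (sideTR n) \<and> edge_out D (cornerT n) (sideLT n)}"

definition pb :: "nat \<Rightarrow> nat" where
  "pb n = card {D \<in> ice_configs n.
     edge_out D (cornerL n) (sideLT n) \<and> edge_out D (cornerL n) (sideLR n) \<and>
     edge_in D (cornerR n) (sideTR n) \<and> edge_in D (cornerR n) (sideLR n) \<and>
     edge_out D (cornerT n) (sideTR n) \<and> edge_in D (cornerT n) (sideLT n)}"

definition pc :: "nat \<Rightarrow> nat" where
  "pc n = card {D \<in> ice_configs n.
     edge_in D (cornerT n) (sideTR n) \<and> edge_out D (cornerT n) (sideLT n) \<and>
     edge_in D (cornerR n) (sideTR n) \<and> edge_out D (cornerR n) (sideLR n) \<and>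
     edge_in D (cornerL n) (sideLR n) \<and> edge_out D (cornerL n) (sideLT n)}"

definition pd :: "nat \<Rightarrow> nat" where
  "pd n = card {D \<in> ice_configs n.
     edge_in D (cornerT n) (sideLT n) \<and> edge_out D (cornerT n) (sideTR n) \<and>
     edge_in D (cornerR n) (sideTR n) \<and> edge_out D (cornerR n) (sideLR n) \<and>
     edge_in D (cornerL n) (sideLR n) \<and> edge_out D (cornerL n) (sideLT n)}"

end

theory Submission
  imports Defs
begin

text \<open>
  Record the six boundary half-edges of a configuration as bits. Gluing three copies of
  \<open>SG(n)\<close> along their shared corners imposes a condition only at these three vertices,
  where two of the four half-edges point in; hence the boundary counts for \<open>SG(n + 1)\<close> are a
  sum over the six balanced patterns at each shared vertex of products of three boundary
  counts for \<open>SG(n)\<close>. By induction all 64 counts are given by four numbers: they vanish unless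
  exactly three bits point in, and the remaining 20 patterns are the images of the four
  prescribed ones under the symmetries of the triangle. That form of the table is
  preserved by the gluing sum, so no symmetry of the graph itself has to be established.
\<close>

section \<open>Orientations of unions and images of graphs\<close>

text \<open>Both arcs of every edge. An orientation of \<open>E\<close> and its converse are then
  subsets of one symmetric relation, and neighbours, out-neighbours and in-neighbours are all images
  of a relation.\<close>

definition adjacency :: "'a set set \<Rightarrow> ('a \<times> 'a) set" where
  "adjacency E = {(u, v). {u, v} \<in> E}"

lemma mem_adjacency [simp]: "(u, v) \<in> adjacency E \<longleftrightarrow> {u, v} \<in> E"
  by (simp add: adjacency_def)

lemma adjacency_Un: "adjacency (E \<union> F) = adjacency E \<union> adjacency F"
  by (auto simp: adjacency_def)

lemma converse_adjacency: "(adjacency E)\<inverse> = adjacency E"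
  by (auto simp: adjacency_def insert_commute)

lemma doubleton_eq_image:
  assumes "inj f" and "{u, v} = f ` e"
  obtains u' v' where "u = f u'" "v = f v'" "e = {u', v'}"
proof -
  obtain u' v' where "u = f u'" "v = f v'"
    using assms(2) by blast
  moreover from this have "f ` e = f ` {u', v'}"
    using assms(2) by simp
  then have "e = {u', v'}"
    using assms(1) by (simp only: inj_image_eq_iff)
  ultimately show ?thesis
    using that by blast
qed

lemma adjacency_image:
  assumes "inj f"
  shows "adjacency ((`) f ` E) = map_prod f f ` adjacency E"
proof (intro subset_antisym image_subsetI subrelI)
  fix u v assume "(u, v) \<in> adjacency ((`) f ` E)"
  then obtain e where "e \<in> E" "{u, v} = f ` e"
    by auto
  then obtain u' v' where "u = f u'" "v = f v'" "{u', v'} \<in> E"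
    using doubleton_eq_image[OF assms] by metis
  then show "(u, v) \<in> map_prod f f ` adjacency E"
    by (intro image_eqI[of _ _ "(u', v')"]) simp_all
next
  fix p assume "p \<in> adjacency E"
  then have "f ` {fst p, snd p} \<in> (`) f ` E"
    by (intro imageI) (simp add: adjacency_def case_prod_beta)
  then show "map_prod f f p \<in> adjacency ((`) f ` E)"
    by (simp add: adjacency_def case_prod_beta)
qed

lemma orientations_iff:
  "D \<in> orientations E \<longleftrightarrow>
    D \<subseteq> adjacency E \<and> (\<forall>u v. {u, v} \<in> E \<longrightarrow> ((u, v) \<in> D \<longleftrightarrow> (v, u) \<notin> D))"
  unfolding orientations_def adjacency_def by blast

lemma orientations_subset: "D \<in> orientations E \<Longrightarrow> D \<subseteq> adjacency E"
  by (simp add: orientations_iff)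

lemma orientations_converse_subset: "D \<in> orientations E \<Longrightarrow> D\<inverse> \<subseteq> adjacency E"
  using converse_adjacency orientations_subset by blast

lemma orientations_Int:
  assumes "D \<in> orientations E" "F \<subseteq> E"
  shows "D \<inter> adjacency F \<in> orientations F"
  unfolding orientations_iff
proof (intro conjI allI impI)
  fix u v assume uv: "{u, v} \<in> F"
  then have vu: "{v, u} \<in> F"
    by (simp only: insert_commute)
  have "(u, v) \<in> D \<longleftrightarrow> (v, u) \<notin> D"
    using assms(1) subsetD[OF assms(2) uv] by (simp add: orientations_iff)
  then show "(u, v) \<in> D \<inter> adjacency F \<longleftrightarrow> (v, u) \<notin> D \<inter> adjacency F"
    using uv vu by simp
qed simp

text \<open>No edge lies in both graphs, so an orientation of the union is a free choice on each
  part; restricting to the arcs of each part is the inverse map.\<close>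

lemma bij_betw_orientations_Un:
  assumes "adjacency E \<inter> adjacency F = {}"
  shows "bij_betw (\<lambda>(C, D). C \<union> D) (orientations E \<times> orientations F) (orientations (E \<union> F))"
proof (rule bij_betw_byWitness[where f' = "\<lambda>G. (G \<inter> adjacency E, G \<inter> adjacency F)"])
  show "\<forall>a\<in>orientations E \<times> orientations F.
      (case case a of (C, D) \<Rightarrow> C \<union> D of G \<Rightarrow> (G \<inter> adjacency E, G \<inter> adjacency F)) = a"
    using assms orientations_subset by fastforce
  show "\<forall>G\<in>orientations (E \<union> F). (case (G \<inter> adjacency E, G \<inter> adjacency F) of (C, D) \<Rightarrow> C \<union> D) = G"
    using orientations_subset by (fastforce simp: adjacency_Un)
  show "(\<lambda>(C, D). C \<union> D) ` (orientations E \<times> orientations F) \<subseteq> orientations (E \<union> F)"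
  proof clarify
    fix C D assume CD: "C \<in> orientations E" "D \<in> orientations F"
    have "(u, v) \<in> C \<union> D \<longleftrightarrow> (v, u) \<notin> C \<union> D" if uv: "{u, v} \<in> E \<union> F" for u v
    proof -
      have sub: "(u, v) \<in> C \<or> (v, u) \<in> C \<longrightarrow> {u, v} \<in> E" "(u, v) \<in> D \<or> (v, u) \<in> D \<longrightarrow> {u, v} \<in> F"
        using CD[THEN orientations_subset] by (auto simp: adjacency_def insert_commute)
      have disj: "{u, v} \<notin> E \<or> {u, v} \<notin> F"
        using assms by (auto simp: adjacency_def)
      show ?thesis
      proof (cases "{u, v} \<in> E")
        case True
        with disj sub CD(1) show ?thesis
          by (simp add: orientations_iff)
      next
        case False
        with uv have "{u, v} \<in> F"
          by simp
        with False sub CD(2) show ?thesis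
          by (simp add: orientations_iff)
      qed
    qed
    then show "C \<union> D \<in> orientations (E \<union> F)"
      using CD by (auto simp: orientations_iff)
  qed
  show "(\<lambda>G. (G \<inter> adjacency E, G \<inter> adjacency F)) ` orientations (E \<union> F)
      \<subseteq> orientations E \<times> orientations F"
    by (intro image_subsetI SigmaI) (auto intro: orientations_Int)
qed

lemma bij_betw_orientations_image:
  assumes "inj f"
  shows "bij_betw ((`) (map_prod f f)) (orientations E) (orientations ((`) f ` E))"
proof (rule bij_betw_byWitness[where f' = "(-`) (map_prod f f)"])
  have inj: "inj (map_prod f f)"
    using assms by (simp add: prod.inj_map)
  then show "\<forall>D\<in>orientations E. map_prod f f -` map_prod f f ` D = D"
    by (simp add: inj_vimage_image_eq)
  \<comment> \<open>Preimage undoes image because \<open>f\<close> is injective. The other direction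
    needs \<open>G\<close> inside the range of \<open>map_prod f f\<close>, which holds since all
    arcs of \<open>G\<close> come from edges of the image graph.\<close>
  show "\<forall>G\<in>orientations ((`) f ` E). map_prod f f ` (map_prod f f -` G) = G"
  proof
    fix G assume "G \<in> orientations ((`) f ` E)"
    then have "G \<subseteq> map_prod f f ` adjacency E"
      using orientations_subset[of G "(`) f ` E"] by (simp only: adjacency_image[OF assms, of E])
    also have "\<dots> \<subseteq> range (map_prod f f)"
      by (rule image_mono) simp
    finally have "G \<subseteq> range (map_prod f f)" .
    then show "map_prod f f ` (map_prod f f -` G) = G"
      by (simp only: image_vimage_eq Int_absorb2)
  qed
  have mem: "(f u, f v) \<in> map_prod f f ` D \<longleftrightarrow> (u, v) \<in> D" for u v D
    using inj_image_mem_iff[OF inj, of "(u, v)"] by (simp only: map_prod_simp)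
  have edge: "{f u, f v} \<in> (`) f ` E \<longleftrightarrow> {u, v} \<in> E" for u v
    using mem[of u v "adjacency E"] by (simp only: adjacency_image[OF assms, symmetric] mem_adjacency)
  show "(`) (map_prod f f) ` orientations E \<subseteq> orientations ((`) f ` E)"
  proof clarify
    fix D assume D: "D \<in> orientations E"
    have "(u, v) \<in> map_prod f f ` D \<longleftrightarrow> (v, u) \<notin> map_prod f f ` D" if "{u, v} \<in> (`) f ` E" for u v
    proof -
      from that obtain e where "e \<in> E" "{u, v} = f ` e"
        by blast
      then obtain u' v' where "u = f u'" "v = f v'" "{u', v'} \<in> E"
        using doubleton_eq_image[OF assms] by metis
      then show ?thesis
        using D by (simp add: mem orientations_iff)
    qed
    then show "map_prod f f ` D \<in> orientations ((`) f ` E)"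
      using D by (auto simp: orientations_iff adjacency_image[OF assms] simp del: mem_adjacency)
  qed
  show "(-`) (map_prod f f) ` orientations ((`) f ` E) \<subseteq> orientations E"
  proof clarify
    fix G assume G: "G \<in> orientations ((`) f ` E)"
    have "{u, v} \<in> E" if "(f u, f v) \<in> G" for u v
      using subsetD[OF orientations_subset[OF G] that] by (simp only: edge mem_adjacency)
    then show "map_prod f f -` G \<in> orientations E"
      using G edge by (auto simp: orientations_iff)
  qed
qed

section \<open>Geometry of the gasket\<close>

abbreviation sg_adj :: "nat \<Rightarrow> (point \<times> point) set" where
  "sg_adj n \<equiv> adjacency (sg_edges n)"

text \<open>\<open>A\<close> stays bottom left, \<open>B\<close> moves to the bottom right and
  \<open>C\<close> to the top. Arbitrary arc sets are allowed, so the lemmas on \<open>glue\<close>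
  serve orientations, their converses and the full relation \<open>sg_adj n\<close> alike.\<close>

definition glue :: "nat \<Rightarrow> (point \<times> point) set \<Rightarrow> (point \<times> point) set \<Rightarrow> (point \<times> point) set \<Rightarrow> (point \<times> point) set"
  where "glue n A B C = A \<union> map_prod ((+) (cornerR n)) ((+) (cornerR n)) ` B
    \<union> map_prod ((+) (cornerT n)) ((+) (cornerT n)) ` C"

lemmas corner_defs = cornerL_def cornerR_def cornerT_def

lemma inj_plus_point: "inj ((+) (p :: point))"
  by (simp add: inj_def)

text \<open>Turns every statement on out-neighbours in a glued set into one on
  in-neighbours.\<close>

lemma converse_glue: "(glue n A B C)\<inverse> = glue n (A\<inverse>) (B\<inverse>) (C\<inverse>)"
  by (auto simp: glue_def)

text \<open>The index sets have at most one element. They replace the subtraction of a corner from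
  \<open>v\<close>, which would truncate on natural numbers, and are empty if \<open>v\<close> is
  not a translate.\<close>

lemma glue_Image:
  "glue n A B C `` {v} = A `` {v} \<union> (+) (cornerR n) ` (\<Union>w\<in>{w. v = cornerR n + w}. B `` {w})
    \<union> (+) (cornerT n) ` (\<Union>w\<in>{w. v = cornerT n + w}. C `` {w})"
  by (fastforce simp: glue_def)

lemma sg_adj_Suc: "sg_adj (Suc n) = glue n (sg_adj n) (sg_adj n) (sg_adj n)"
  by (simp add: glue_def adjacency_Un adjacency_image[OF inj_plus_point])

lemma finite_sg_verts: "finite (sg_verts n)"
  by (induction n) auto

text \<open>The source of all separation arguments: a point with coordinate sum at most
  \<open>2 ^ n\<close> and one coordinate at least \<open>2 ^ n\<close> must be a corner.\<close>

lemma sg_verts_le: "(x, y) \<in> sg_verts n \<Longrightarrow> x + y \<le> 2 ^ n"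
proof (induction n arbitrary: x y)
  case (Suc n)
  then show ?case
    by (fastforce simp: corner_defs)
qed (auto simp: corner_defs)

lemma sg_adj_verts: "(u, v) \<in> sg_adj n \<Longrightarrow> u \<in> sg_verts n \<and> v \<in> sg_verts n \<and> u \<noteq> v"
proof (induction n arbitrary: u v)
  case 0
  then show ?case
    by (auto simp: corner_defs doubleton_eq_iff)
next
  case (Suc n)
  then have "(u, v) \<in> glue n (sg_adj n) (sg_adj n) (sg_adj n)"
    by (simp only: sg_adj_Suc)
  then show ?case
    using Suc.IH unfolding glue_def by fastforce
qed

lemma corners_in_sg_verts: "cornerL n \<in> sg_verts n" "cornerR n \<in> sg_verts n" "cornerT n \<in> sg_verts n"
proof (induction n)
  case (Suc n)
  have "cornerR (Suc n) = cornerR n + cornerR n" "cornerT (Suc n) = cornerT n + cornerT n" "cornerL (Suc n) = cornerL n"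
    by (simp_all add: corner_defs)
  then show "cornerL (Suc n) \<in> sg_verts (Suc n)" "cornerR (Suc n) \<in> sg_verts (Suc n)"
    "cornerT (Suc n) \<in> sg_verts (Suc n)"
    using Suc by auto
qed auto

lemma subset_sg_adjD:
  assumes "D \<subseteq> sg_adj n" and "(u, v) \<in> D"
  shows "u \<in> sg_verts n" "v \<in> sg_verts n" "u \<noteq> v"
    "fst u + snd u \<le> 2 ^ n" "fst v + snd v \<le> 2 ^ n"
  using assms sg_adj_verts[of u v n] sg_verts_le[of "fst u" "snd u" n] sg_verts_le[of "fst v" "snd v" n]
  by auto

lemma finite_Image_sg: "D \<subseteq> sg_adj n \<Longrightarrow> finite (D `` {v})"
  by (rule finite_subset[OF _ finite_sg_verts[of n]]) (auto dest: subset_sg_adjD)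

section \<open>Neighbourhoods in a glued arc set\<close>

context
  fixes n :: nat and A B C :: "(point \<times> point) set"
  assumes sub: "A \<subseteq> sg_adj n" "B \<subseteq> sg_adj n" "C \<subseteq> sg_adj n"
begin

lemma glue_Image_L:
  assumes "v \<in> sg_verts n" "v \<noteq> cornerR n" "v \<noteq> cornerT n"
  shows "glue n A B C `` {v} = A `` {v}"
proof -
  obtain x y where v: "v = (x, y)"
    by (cases v)
  have "x + y \<le> 2 ^ n"
    using assms(1) v sg_verts_le by simp
  then have "{w. v = cornerR n + w} = {}" "{w. v = cornerT n + w} = {}"
    using assms(2,3) by (auto simp: v corner_defs)
  then show ?thesis
    by (simp only: glue_Image UN_empty UN_insert Union_empty image_empty Un_empty_left Un_empty_right)
qed

lemma glue_Image_R:
  assumes "v \<in> sg_verts n" "v \<noteq> cornerL n" "v \<noteq> cornerT n"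
  shows "glue n A B C `` {cornerR n + v} = (+) (cornerR n) ` (B `` {v})"
proof -
  obtain x y where v: "v = (x, y)"
    by (cases v)
  have le: "x + y \<le> 2 ^ n"
    using assms(1) v sg_verts_le by simp
  \<comment> \<open>The shifted vertex has coordinate sum above \<open>2 ^ n\<close> unless
    \<open>v\<close> is the origin, that is \<open>cornerL n\<close>.\<close>
  have "A `` {cornerR n + v} = {}"
    using subset_sg_adjD(4)[OF sub(1), of "cornerR n + v"] assms(2) by (auto simp: v corner_defs)
  moreover have "{w. cornerR n + v = cornerR n + w} = {v}"
    by auto
  moreover have "{w. cornerR n + v = cornerT n + w} = {}"
    using assms(3) le by (auto simp: v corner_defs)
  ultimately show ?thesis
    by (simp only: glue_Image UN_empty UN_insert Union_empty image_empty Un_empty_left Un_empty_right)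
qed

lemma glue_Image_T:
  assumes "v \<in> sg_verts n" "v \<noteq> cornerL n" "v \<noteq> cornerR n"
  shows "glue n A B C `` {cornerT n + v} = (+) (cornerT n) ` (C `` {v})"
proof -
  obtain x y where v: "v = (x, y)"
    by (cases v)
  have le: "x + y \<le> 2 ^ n"
    using assms(1) v sg_verts_le by simp
  have "A `` {cornerT n + v} = {}"
    using subset_sg_adjD(4)[OF sub(1), of "cornerT n + v"] assms(2) by (auto simp: v corner_defs)
  moreover have "{w. cornerT n + v = cornerT n + w} = {v}"
    by auto
  moreover have "{w. cornerT n + v = cornerR n + w} = {}"
    using assms(3) le by (auto simp: v corner_defs)
  ultimately show ?thesis
    by (simp only: glue_Image UN_empty UN_insert Union_empty image_empty Un_empty_left Un_empty_right)
qed

text \<open>The neighbours contributed by the two copies are disjoint: a common one would have first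
  coordinate at least \<open>2 ^ n\<close> and coordinate sum at most \<open>2 ^ n\<close>, hence be
  \<open>cornerR n\<close> itself, but arcs are loop-free.\<close>

lemma card_glue_Image_LR:
  "card (glue n A B C `` {cornerR n}) = card (A `` {cornerR n}) + card (B `` {cornerL n})"
proof -
  have "{w. cornerR n = cornerR n + w} = {cornerL n}" "{w. cornerR n = cornerT n + w} = {}"
    by (auto simp: corner_defs zero_prod_def)
  then have "glue n A B C `` {cornerR n} = A `` {cornerR n} \<union> (+) (cornerR n) ` (B `` {cornerL n})"
    by (simp only: glue_Image UN_empty UN_insert Union_empty image_empty Un_empty_left Un_empty_right)
  moreover have "u \<noteq> cornerR n + w" if "(cornerR n, u) \<in> A" for u w
    using subset_sg_adjD(3,5)[OF sub(1) that] by (cases u; cases w) (auto simp: corner_defs)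
  then have "A `` {cornerR n} \<inter> (+) (cornerR n) ` (B `` {cornerL n}) = {}"
    by blast
  ultimately show ?thesis
    using finite_Image_sg sub
    by (simp add: card_Un_disjoint card_image inj_plus_point[THEN inj_on_subset])
qed

lemma card_glue_Image_LT:
  "card (glue n A B C `` {cornerT n}) = card (A `` {cornerT n}) + card (C `` {cornerL n})"
proof -
  have "{w. cornerT n = cornerT n + w} = {cornerL n}" "{w. cornerT n = cornerR n + w} = {}"
    by (auto simp: corner_defs zero_prod_def)
  then have "glue n A B C `` {cornerT n} = A `` {cornerT n} \<union> (+) (cornerT n) ` (C `` {cornerL n})"
    by (simp only: glue_Image UN_empty UN_insert Union_empty image_empty Un_empty_left Un_empty_right)
  moreover have "u \<noteq> cornerT n + w" if "(cornerT n, u) \<in> A" for u w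
    using subset_sg_adjD(3,5)[OF sub(1) that] by (cases u; cases w) (auto simp: corner_defs)
  then have "A `` {cornerT n} \<inter> (+) (cornerT n) ` (C `` {cornerL n}) = {}"
    by blast
  ultimately show ?thesis
    using finite_Image_sg sub
    by (simp add: card_Un_disjoint card_image inj_plus_point[THEN inj_on_subset])
qed

lemma card_glue_Image_RT:
  "card (glue n A B C `` {cornerR n + cornerT n}) = card (B `` {cornerT n}) + card (C `` {cornerR n})"
proof -
  have "A `` {cornerR n + cornerT n} = {}"
    using subset_sg_adjD(4)[OF sub(1), of "cornerR n + cornerT n"] by (auto simp: corner_defs)
  moreover have "{w. cornerR n + cornerT n = cornerR n + w} = {cornerT n}"
      "{w. cornerR n + cornerT n = cornerT n + w} = {cornerR n}"
    by (auto simp: corner_defs)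
  ultimately have "glue n A B C `` {cornerR n + cornerT n} =
      (+) (cornerR n) ` (B `` {cornerT n}) \<union> (+) (cornerT n) ` (C `` {cornerR n})"
    by (simp only: glue_Image UN_empty UN_insert Union_empty image_empty Un_empty_left Un_empty_right)
  \<comment> \<open>A common neighbour would force \<open>u\<close> to have second coordinate at
    least \<open>2 ^ n\<close>, so \<open>u = cornerT n\<close>, a loop.\<close>
  moreover have "(+) (cornerR n) ` (B `` {cornerT n}) \<inter> (+) (cornerT n) ` (C `` {cornerR n}) = {}"
  proof (rule equals0I)
    fix x assume "x \<in> (+) (cornerR n) ` (B `` {cornerT n}) \<inter> (+) (cornerT n) ` (C `` {cornerR n})"
    then obtain u w where "(cornerT n, u) \<in> B" "x = cornerR n + u" "x = cornerT n + w"
      by auto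
    then show False
      using subset_sg_adjD(3,5)[OF sub(2), of "cornerT n" u] by (cases u; cases w) (auto simp: corner_defs)
  qed
  ultimately show ?thesis
    using finite_Image_sg sub
    by (simp add: card_Un_disjoint card_image inj_plus_point[THEN inj_on_subset])
qed

end

section \<open>Inner vertices and degrees\<close>

definition sg_inner :: "nat \<Rightarrow> point set" where
  "sg_inner n = sg_verts n - {cornerL n, cornerR n, cornerT n}"

lemma corner_Suc:
  "cornerL (Suc n) = cornerL n" "cornerR (Suc n) = cornerR n + cornerR n"
  "cornerT (Suc n) = cornerT n + cornerT n"
  by (simp_all add: corner_defs)

lemma corners_distinct: "cornerL n \<noteq> cornerR n" "cornerL n \<noteq> cornerT n" "cornerR n \<noteq> cornerT n"
  by (simp_all add: corner_defs)

text \<open>Of the nine corners of the three copies, three become the corners of the large triangle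
  and the other six are identified in pairs.\<close>

lemma sg_inner_Suc:
  "sg_inner (Suc n) = sg_inner n \<union> (+) (cornerR n) ` sg_inner n \<union> (+) (cornerT n) ` sg_inner n
    \<union> {cornerR n, cornerT n, cornerR n + cornerT n}" (is "_ = ?S")
proof (intro subset_antisym subsetI)
  fix v assume v: "v \<in> sg_inner (Suc n)"
  have shifts: "cornerR n + cornerL n = cornerR n" "cornerT n + cornerL n = cornerT n"
    "cornerT n + cornerR n = cornerR n + cornerT n"
    by (simp_all add: corner_defs)
  from v consider "v \<in> sg_verts n" | w where "w \<in> sg_verts n" "v = cornerR n + w"
    | w where "w \<in> sg_verts n" "v = cornerT n + w"
    by (auto simp: sg_inner_def)
  then show "v \<in> ?S"
    using v shifts by cases (auto simp: sg_inner_def corner_Suc)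
next
  fix v assume "v \<in> ?S"
  then consider "v \<in> sg_inner n" | w where "w \<in> sg_inner n" "v = cornerR n + w"
    | w where "w \<in> sg_inner n" "v = cornerT n + w"
    | "v = cornerR n" | "v = cornerT n" | "v = cornerR n + cornerT n"
    by blast
  then show "v \<in> sg_inner (Suc n)"
  proof cases
    case 1
    then have "v \<in> sg_verts (Suc n)"
      by (simp add: sg_inner_def)
    then show ?thesis
      using 1 sg_verts_le[of "fst v" "snd v" n]
      by (cases v) (auto simp: sg_inner_def corner_defs simp del: sg_verts.simps)
  next
    case 2
    then have "v \<in> sg_verts (Suc n)"
      by (simp add: sg_inner_def)
    then show ?thesis
      using 2 by (cases w) (auto simp: sg_inner_def corner_defs simp del: sg_verts.simps)
  next
    case 3
    then have "v \<in> sg_verts (Suc n)"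
      by (simp add: sg_inner_def)
    then show ?thesis
      using 3 by (cases w) (auto simp: sg_inner_def corner_defs simp del: sg_verts.simps)
  next
    case 6
    then have "v \<in> sg_verts (Suc n)"
      using corners_in_sg_verts by simp
    then show ?thesis
      using 6 by (simp add: sg_inner_def corner_defs del: sg_verts.simps)
  qed (use corners_in_sg_verts in \<open>simp_all add: sg_inner_def corner_defs\<close>)
qed

text \<open>An outmost vertex belongs to a single copy, so gluing only translates its neighbourhood.
  In the analogues for \<open>R\<close> and \<open>T\<close> the subtraction
  \<open>2 ^ n - 1\<close> never truncates.\<close>

lemma sg_adj_cornerL: "sg_adj n `` {cornerL n} = {(1, 0), (0, 1)}"
proof (induction n)
  case 0
  show ?case
    by (auto simp: corner_defs doubleton_eq_iff)
next
  case (Suc n)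
  have "sg_adj (Suc n) `` {cornerL (Suc n)} = sg_adj n `` {cornerL n}"
    unfolding sg_adj_Suc corner_Suc
    by (intro glue_Image_L) (simp_all add: corners_in_sg_verts corners_distinct)
  with Suc show ?case
    by simp
qed

lemma sg_adj_cornerR: "sg_adj n `` {cornerR n} = {(2 ^ n - 1, 0), (2 ^ n - 1, 1)}"
proof (induction n)
  case 0
  show ?case
    by (auto simp: corner_defs doubleton_eq_iff)
next
  case (Suc n)
  have "sg_adj (Suc n) `` {cornerR (Suc n)} = (+) (cornerR n) ` (sg_adj n `` {cornerR n})"
    unfolding sg_adj_Suc corner_Suc
    by (intro glue_Image_R) (simp_all add: corners_in_sg_verts corners_distinct corners_distinct[symmetric])
  then show ?case
    unfolding Suc.IH by (simp add: cornerR_def mult_2)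
qed

lemma sg_adj_cornerT: "sg_adj n `` {cornerT n} = {(0, 2 ^ n - 1), (1, 2 ^ n - 1)}"
proof (induction n)
  case 0
  show ?case
    by (auto simp: corner_defs doubleton_eq_iff)
next
  case (Suc n)
  have "sg_adj (Suc n) `` {cornerT (Suc n)} = (+) (cornerT n) ` (sg_adj n `` {cornerT n})"
    unfolding sg_adj_Suc corner_Suc
    by (intro glue_Image_T) (simp_all add: corners_in_sg_verts corners_distinct corners_distinct[symmetric])
  then show ?case
    unfolding Suc.IH by (simp add: cornerT_def mult_2)
qed

lemma card_sg_adj_corner:
  "card (sg_adj n `` {cornerL n}) = 2" "card (sg_adj n `` {cornerR n}) = 2" "card (sg_adj n `` {cornerT n}) = 2"
  by (simp_all only: sg_adj_cornerL sg_adj_cornerR sg_adj_cornerT) simp_all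

lemma card_glue_Image_inner:
  assumes "A \<subseteq> sg_adj n" "B \<subseteq> sg_adj n" "C \<subseteq> sg_adj n" "v \<in> sg_inner n"
  shows "card (glue n A B C `` {v}) = card (A `` {v})"
    "card (glue n A B C `` {cornerR n + v}) = card (B `` {v})"
    "card (glue n A B C `` {cornerT n + v}) = card (C `` {v})"
  using assms
  by (simp_all add: sg_inner_def glue_Image_L[of A n B C] glue_Image_R[of A n B C] glue_Image_T[of A n B C]
      card_image inj_plus_point[THEN inj_on_subset])

text \<open>Inner vertices of a copy keep their neighbourhood up to translation; each shared vertex
  gets two neighbours from either copy.\<close>

lemma card_sg_adj_inner: "v \<in> sg_inner n \<Longrightarrow> card (sg_adj n `` {v}) = 4"
proof (induction n arbitrary: v)
  case 0
  then show ?case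
    by (simp add: sg_inner_def)
next
  case (Suc n)
  note [simp del] = Image_singleton_iff
  have "\<And>w. w \<in> sg_inner n \<Longrightarrow> card (sg_adj (Suc n) `` {w}) = 4"
      "\<And>w. w \<in> sg_inner n \<Longrightarrow> card (sg_adj (Suc n) `` {cornerR n + w}) = 4"
      "\<And>w. w \<in> sg_inner n \<Longrightarrow> card (sg_adj (Suc n) `` {cornerT n + w}) = 4"
    unfolding sg_adj_Suc by (simp_all only: card_glue_Image_inner[OF subset_refl subset_refl subset_refl] Suc.IH)
  moreover have "card (sg_adj (Suc n) `` {cornerR n}) = 4" "card (sg_adj (Suc n) `` {cornerT n}) = 4"
      "card (sg_adj (Suc n) `` {cornerR n + cornerT n}) = 4"
    unfolding sg_adj_Suc by (simp_all add: card_glue_Image_LR card_glue_Image_LT card_glue_Image_RT card_sg_adj_corner)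
  ultimately show ?case
    using Suc.prems unfolding sg_inner_Suc by blast
qed

lemma sg_edges_doubleton: "e \<in> sg_edges n \<Longrightarrow> \<exists>u v. e = {u, v}"
proof (induction n arbitrary: e)
  case (Suc n)
  then obtain e' f where "e' \<in> sg_edges n" "e = e' \<or> e = f ` e'"
    by auto
  moreover obtain u v where "e' = {u, v}"
    using Suc.IH calculation(1) by blast
  ultimately have "e = {u, v} \<or> e = {f u, f v}"
    by simp
  then show ?case
    by blast
qed (unfold sg_edges.simps, blast)

lemma vertex_degree_eq_card_adjacency:
  assumes "\<And>e. e \<in> E \<Longrightarrow> \<exists>u v. e = {u, v}"
  shows "vertex_degree E v = card (adjacency E `` {v})"
proof -
  have "{e \<in> E. v \<in> e} = (\<lambda>u. {v, u}) ` (adjacency E `` {v})"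
    using assms by (fastforce simp: insert_commute)
  moreover have "inj_on (\<lambda>u. {v, u}) (adjacency E `` {v})"
    by (auto simp: inj_on_def doubleton_eq_iff)
  ultimately show ?thesis
    by (simp add: vertex_degree_def card_image)
qed

text \<open>Corners have degree 2 and all other vertices degree 4, so the degree test amounts to
  membership in \<open>sg_inner n\<close>, a set with a recursion of its own.\<close>

lemma ice_configs_iff:
  "D \<in> ice_configs n \<longleftrightarrow> D \<in> orientations (sg_edges n) \<and>
    (\<forall>v \<in> sg_inner n. card (D\<inverse> `` {v}) = 2 \<and> card (D `` {v}) = 2)"
proof -
  have "vertex_degree (sg_edges n) v = 4 \<longleftrightarrow> v \<in> sg_inner n" if "v \<in> sg_verts n" for v
  proof (cases "v \<in> sg_inner n")
    case False
    then have "v = cornerL n \<or> v = cornerR n \<or> v = cornerT n"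
      using that by (auto simp: sg_inner_def)
    then show ?thesis
      using False card_sg_adj_corner[of n]
      by (auto simp: vertex_degree_eq_card_adjacency[OF sg_edges_doubleton] simp del: Image_singleton_iff)
  qed (simp add: vertex_degree_eq_card_adjacency[OF sg_edges_doubleton] card_sg_adj_inner)
  moreover have "D\<inverse> `` {v} = {u. (u, v) \<in> D}" "D `` {v} = {u. (v, u) \<in> D}" for v
    by auto
  moreover have "sg_inner n \<subseteq> sg_verts n"
    by (auto simp: sg_inner_def)
  ultimately show ?thesis
    by (auto simp: ice_configs_def)
qed

section \<open>Boundary tables and the gluing sum\<close>

text \<open>
  The arguments \<open>la, \<dots>, tb\<close> run through the half-edges counterclockwise from the side
  \<open>LT\<close> at \<open>L\<close>, with \<open>True\<close> for an edge pointing toward the corner, so \<open>lb, ra\<close> lie on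
  \<open>LR\<close>, \<open>rb, ta\<close> on \<open>TR\<close> and \<open>tb, la\<close> on \<open>LT\<close>. If exactly one corner is mixed, the count is
  \<open>a\<close> iff its in-edge lies on the side toward the corner with two in-edges.
\<close>

definition boundary_count :: "nat \<Rightarrow> nat \<Rightarrow> nat \<Rightarrow> nat \<Rightarrow> bool \<Rightarrow> bool \<Rightarrow> bool \<Rightarrow> bool \<Rightarrow> bool \<Rightarrow> bool \<Rightarrow> nat"
  where "boundary_count a b c d la lb ra rb ta tb =
    (if la = lb then
       if ra = rb then if la \<noteq> ra \<and> ta \<noteq> tb then if tb = la then a else b else 0
       else if ta = tb \<and> ta \<noteq> la then if rb = ta then a else b else 0
     else if ra = rb then if ta = tb \<and> ta \<noteq> ra then if lb = ra then a else b else 0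
     else if ta = tb then 0
     else if la = ra \<and> ra = ta then d else c)"

text \<open>Evaluates \<open>boundary_count\<close> at all 64 bit patterns in advance, so that large
  sums can be rewritten without case splits on the conditionals.\<close>

lemmas boundary_count_1 = boundary_count_def[where la = True] boundary_count_def[where la = False]
lemmas boundary_count_2 = boundary_count_1[where lb = True] boundary_count_1[where lb = False]
lemmas boundary_count_3 = boundary_count_2[where ra = True] boundary_count_2[where ra = False]
lemmas boundary_count_4 = boundary_count_3[where rb = True] boundary_count_3[where rb = False]
lemmas boundary_count_5 = boundary_count_4[where ta = True] boundary_count_4[where ta = False]
lemmas boundary_count_table = boundary_count_5[where tb = True, simplified] boundary_count_5[where tb = False, simplified]

definition balanced :: "(bool \<times> bool \<times> bool \<times> bool) set" where
  "balanced = {(True, True, False, False), (True, False, True, False), (True, False, False, True),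
    (False, True, True, False), (False, True, False, True), (False, False, True, True)}"

lemma mem_balanced_iff:
  "(w, x, y, z) \<in> balanced \<longleftrightarrow> (of_bool w + of_bool x + of_bool y + of_bool z :: nat) = 2"
  by (cases w; cases x; cases y; cases z) (simp_all add: balanced_def)

lemma sum_balanced:
  fixes f :: "bool \<times> bool \<times> bool \<times> bool \<Rightarrow> nat"
  shows "(\<Sum>q\<in>balanced. f q) =
    f (True, True, False, False) + f (True, False, True, False) + f (True, False, False, True) +
    f (False, True, True, False) + f (False, True, False, True) + f (False, False, True, True)"
  by (simp add: balanced_def)

text \<open>The \<open>p\<close> bits sit at the vertex shared by the two bottom copies,
  \<open>q\<close> at the one shared by right and top, \<open>s\<close> at the one shared by left
  and top. The three factors belong to the left, right and top copy; each takes its bits in the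
  order \<open>L\<close>, \<open>R\<close>, \<open>T\<close> of its own corners.\<close>

definition glue_count ::
  "(bool \<Rightarrow> bool \<Rightarrow> bool \<Rightarrow> bool \<Rightarrow> bool \<Rightarrow> bool \<Rightarrow> nat) \<Rightarrow>
   bool \<Rightarrow> bool \<Rightarrow> bool \<Rightarrow> bool \<Rightarrow> bool \<Rightarrow> bool \<Rightarrow> nat"
  where "glue_count f la lb ra rb ta tb =
    (\<Sum>(p1, p2, p3, p4)\<in>balanced. \<Sum>(q1, q2, q3, q4)\<in>balanced. \<Sum>(s1, s2, s3, s4)\<in>balanced.
       f la lb p1 p2 s1 s2 * f p3 p4 ra rb q1 q2 * f s3 s4 q3 q4 ta tb)"

text \<open>A finite computation: 64 patterns, 216 products each. The zeros persist because a
  nonzero product has three in-bits per copy, nine in all, of which the balanced shared vertices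
  absorb six.\<close>

lemma glue_count_boundary_count:
  "glue_count (boundary_count a b c d) la lb ra rb ta tb =
    boundary_count ((a + b)\<^sup>2 * (a + 3 * c + d)) ((a + b)\<^sup>2 * (b + 3 * c + d))
      (a\<^sup>2 * b + b\<^sup>2 * a + (3 * c + d) ^ 3) (a ^ 3 + b ^ 3 + (3 * c + d) ^ 3) la lb ra rb ta tb"
  unfolding glue_count_def sum_balanced prod.case
  by (cases la; cases lb; cases ra; cases rb; cases ta; cases tb;
      \<comment> \<open>Vanishing products are removed first; only the surviving terms reach the
        polynomial arithmetic.\<close>
      simp only: boundary_count_table mult_zero_left mult_zero_right add_0_left add_0_right;
      simp add: algebra_simps power2_eq_square power3_eq_cube)

section \<open>Counting configurations\<close>

definition boundary :: "nat \<Rightarrow> (point \<times> point) set \<Rightarrow> bool \<times> bool \<times> bool \<times> bool \<times> bool \<times> bool" where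
  "boundary n D =
    (edge_in D (cornerL n) (sideLT n), edge_in D (cornerL n) (sideLR n),
     edge_in D (cornerR n) (sideLR n), edge_in D (cornerR n) (sideTR n),
     edge_in D (cornerT n) (sideTR n), edge_in D (cornerT n) (sideLT n))"

section \<open>Half-edges at the corners\<close>

lemma edge_in_iff: "edge_in D v S \<longleftrightarrow> S \<inter> D\<inverse> `` {v} \<noteq> {}"
  by (auto simp: edge_in_def)

lemma edge_in_orientation_iff:
  assumes "D \<in> orientations E" "adjacency E `` {v} \<inter> S = {a}"
  shows "edge_in D v S \<longleftrightarrow> (a, v) \<in> D"
  using assms orientations_converse_subset[OF assms(1)] by (auto simp: edge_in_def simp del: mem_adjacency)

text \<open>In and out are complementary because the side \<open>S\<close> contains exactly one
  neighbour of \<open>v\<close>, whose edge has exactly one direction.\<close>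

lemma edge_out_orientation_iff:
  assumes "D \<in> orientations E" "adjacency E `` {v} \<inter> S = {a}"
  shows "edge_out D v S \<longleftrightarrow> \<not> edge_in D v S"
proof -
  have "edge_out D v S \<longleftrightarrow> (v, a) \<in> D"
    using assms orientations_subset[OF assms(1)] by (auto simp: edge_out_def simp del: mem_adjacency)
  moreover have "{v, a} \<in> E"
    using assms(2) by auto
  ultimately show ?thesis
    using assms by (simp add: edge_in_orientation_iff orientations_iff)
qed

lemma card_subset_doubleton:
  assumes "X \<subseteq> {a, b}" "a \<noteq> b"
  shows "card X = of_bool (a \<in> X) + of_bool (b \<in> X)"
proof -
  have "card ({a, b} \<inter> X) = of_bool (a \<in> X) + of_bool (b \<in> X)"
    using assms(2) by (simp add: Int_insert_left)
  then show ?thesis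
    using assms(1) by (simp add: Int_absorb1)
qed

lemma card_Image_orientation:
  assumes D: "D \<in> orientations E"
    and ab: "adjacency E `` {v} = {a, b}" "a \<noteq> b" "adjacency E `` {v} \<inter> S = {a}" "adjacency E `` {v} \<inter> S' = {b}"
  shows "card (D\<inverse> `` {v}) = of_bool (edge_in D v S) + of_bool (edge_in D v S')"
    and "card (D `` {v}) = of_bool (\<not> edge_in D v S) + of_bool (\<not> edge_in D v S')"
proof -
  have sub: "D\<inverse> `` {v} \<subseteq> {a, b}" "D `` {v} \<subseteq> {a, b}"
    using ab(1) orientations_subset[OF D] orientations_converse_subset[OF D] by blast+
  have "a \<in> adjacency E `` {v}" "b \<in> adjacency E `` {v}"
    using ab(1) by blast+
  then have out: "(v, a) \<in> D \<longleftrightarrow> (a, v) \<notin> D" "(v, b) \<in> D \<longleftrightarrow> (b, v) \<notin> D"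
    using D by (simp_all add: orientations_iff)
  show "card (D\<inverse> `` {v}) = of_bool (edge_in D v S) + of_bool (edge_in D v S')"
    using card_subset_doubleton[OF sub(1) ab(2)]
    by (simp add: edge_in_orientation_iff[OF D ab(3)] edge_in_orientation_iff[OF D ab(4)])
  show "card (D `` {v}) = of_bool (\<not> edge_in D v S) + of_bool (\<not> edge_in D v S')"
    using card_subset_doubleton[OF sub(2) ab(2)] out
    by (simp add: edge_in_orientation_iff[OF D ab(3)] edge_in_orientation_iff[OF D ab(4)])
qed

lemma sg_adj_cornerL_side:
  "sg_adj n `` {cornerL n} \<inter> sideLT n = {(0, 1)}" "sg_adj n `` {cornerL n} \<inter> sideLR n = {(1, 0)}"
  unfolding sg_adj_cornerL by (auto simp: sideLT_def sideLR_def)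

lemma sg_adj_cornerR_side:
  "sg_adj n `` {cornerR n} \<inter> sideLR n = {(2 ^ n - 1, 0)}" "sg_adj n `` {cornerR n} \<inter> sideTR n = {(2 ^ n - 1, 1)}"
  unfolding sg_adj_cornerR by (auto simp: less_imp_neq sideTR_def sideLR_def)

lemma sg_adj_cornerT_side:
  "sg_adj n `` {cornerT n} \<inter> sideTR n = {(1, 2 ^ n - 1)}" "sg_adj n `` {cornerT n} \<inter> sideLT n = {(0, 2 ^ n - 1)}"
  unfolding sg_adj_cornerT by (auto simp: less_imp_neq sideTR_def sideLT_def)

lemma card_Image_corner:
  assumes "D \<in> orientations (sg_edges n)" "boundary n D = (la, lb, ra, rb, ta, tb)"
  shows "card (D\<inverse> `` {cornerL n}) = of_bool la + of_bool lb" "card (D `` {cornerL n}) = of_bool (\<not> la) + of_bool (\<not> lb)"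
    "card (D\<inverse> `` {cornerR n}) = of_bool ra + of_bool rb" "card (D `` {cornerR n}) = of_bool (\<not> ra) + of_bool (\<not> rb)"
    "card (D\<inverse> `` {cornerT n}) = of_bool ta + of_bool tb" "card (D `` {cornerT n}) = of_bool (\<not> ta) + of_bool (\<not> tb)"
proof -
  have "edge_in D (cornerL n) (sideLT n) = la" "edge_in D (cornerL n) (sideLR n) = lb"
      "edge_in D (cornerR n) (sideLR n) = ra" "edge_in D (cornerR n) (sideTR n) = rb"
      "edge_in D (cornerT n) (sideTR n) = ta" "edge_in D (cornerT n) (sideLT n) = tb"
    using assms(2) by (simp_all add: boundary_def)
  note bits = this
  show "card (D\<inverse> `` {cornerL n}) = of_bool la + of_bool lb"
      "card (D `` {cornerL n}) = of_bool (\<not> la) + of_bool (\<not> lb)"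
    using card_Image_orientation[OF assms(1) sg_adj_cornerL _ sg_adj_cornerL_side(2,1)]
    unfolding bits by simp_all
  show "card (D\<inverse> `` {cornerR n}) = of_bool ra + of_bool rb"
      "card (D `` {cornerR n}) = of_bool (\<not> ra) + of_bool (\<not> rb)"
    using card_Image_orientation[OF assms(1) sg_adj_cornerR _ sg_adj_cornerR_side]
    unfolding bits by simp_all
  show "card (D\<inverse> `` {cornerT n}) = of_bool ta + of_bool tb"
      "card (D `` {cornerT n}) = of_bool (\<not> ta) + of_bool (\<not> tb)"
    using card_Image_orientation[OF assms(1) sg_adj_cornerT _ sg_adj_cornerT_side(2,1)]
    unfolding bits by simp_all
qed

section \<open>Gluing configurations\<close>

lemma glue_mem_ice_configs_iff:
  assumes o: "A \<in> orientations (sg_edges n)" "B \<in> orientations (sg_edges n)" "C \<in> orientations (sg_edges n)"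
      "glue n A B C \<in> orientations (sg_edges (Suc n))"
    and b: "boundary n A = (la, lb, p1, p2, s1, s2)" "boundary n B = (p3, p4, ra, rb, q1, q2)"
      "boundary n C = (s3, s4, q3, q4, ta, tb)"
  shows "glue n A B C \<in> ice_configs (Suc n) \<longleftrightarrow>
    A \<in> ice_configs n \<and> B \<in> ice_configs n \<and> C \<in> ice_configs n \<and>
    (p1, p2, p3, p4) \<in> balanced \<and> (q1, q2, q3, q4) \<in> balanced \<and> (s1, s2, s3, s4) \<in> balanced"
proof -
  define ok where "ok D v \<longleftrightarrow> card (D\<inverse> `` {v}) = 2 \<and> card (D `` {v}) = 2" for D :: "(point \<times> point) set" and v
  let ?G = "glue n A B C"
  note sub = o(1-3)[THEN orientations_subset] and sub' = o(1-3)[THEN orientations_converse_subset]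
  have inner: "ok ?G v = ok A v" "ok ?G (cornerR n + v) = ok B v" "ok ?G (cornerT n + v) = ok C v"
    if "v \<in> sg_inner n" for v
    by (simp_all add: ok_def converse_glue card_glue_Image_inner[OF sub that] card_glue_Image_inner[OF sub' that])
  \<comment> \<open>Bracketed as the shared-corner lemmas produce it: \<open>w\<close>,
    \<open>x\<close> come from one copy and \<open>y\<close>, \<open>z\<close> from the other. Among
    four half-edges, two pointing in already means two pointing out.\<close>
  have two: "(of_bool w + of_bool x + (of_bool y + of_bool z) = (2 :: nat) \<and>
      of_bool (\<not> w) + of_bool (\<not> x) + (of_bool (\<not> y) + of_bool (\<not> z)) = (2 :: nat)) \<longleftrightarrow>
      (w, x, y, z) \<in> balanced" for w x y z
    by (cases w; cases x; cases y; cases z) (simp_all add: mem_balanced_iff)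
  have shared: "ok ?G (cornerR n) \<longleftrightarrow> (p1, p2, p3, p4) \<in> balanced"
      "ok ?G (cornerT n) \<longleftrightarrow> (s1, s2, s3, s4) \<in> balanced"
      "ok ?G (cornerR n + cornerT n) \<longleftrightarrow> (q1, q2, q3, q4) \<in> balanced"
    unfolding ok_def converse_glue two[symmetric]
      card_glue_Image_LR[OF sub] card_glue_Image_LT[OF sub] card_glue_Image_RT[OF sub]
      card_glue_Image_LR[OF sub'] card_glue_Image_LT[OF sub'] card_glue_Image_RT[OF sub']
      card_Image_corner[OF o(1) b(1)] card_Image_corner[OF o(2) b(2)] card_Image_corner[OF o(3) b(3)]
    by (rule refl)+
  have "(\<forall>v\<in>sg_inner (Suc n). ok ?G v) \<longleftrightarrow>
      (\<forall>v\<in>sg_inner n. ok ?G v) \<and> (\<forall>v\<in>sg_inner n. ok ?G (cornerR n + v)) \<and> (\<forall>v\<in>sg_inner n. ok ?G (cornerT n + v))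
      \<and> ok ?G (cornerR n) \<and> ok ?G (cornerT n) \<and> ok ?G (cornerR n + cornerT n)"
    unfolding sg_inner_Suc by blast
  then show ?thesis
    using o inner shared by (auto simp: ice_configs_iff simp flip: ok_def)
qed

lemma boundary_glue:
  assumes o: "A \<in> orientations (sg_edges n)" "B \<in> orientations (sg_edges n)" "C \<in> orientations (sg_edges n)"
    and b: "boundary n A = (la, lb, p1, p2, s1, s2)" "boundary n B = (p3, p4, ra, rb, q1, q2)"
      "boundary n C = (s3, s4, q3, q4, ta, tb)"
  shows "boundary (Suc n) (glue n A B C) = (la, lb, ra, rb, ta, tb)"
proof -
  note sub = o[THEN orientations_converse_subset]
  have im: "(glue n A B C)\<inverse> `` {cornerL (Suc n)} = A\<inverse> `` {cornerL n}"
      "(glue n A B C)\<inverse> `` {cornerR (Suc n)} = (+) (cornerR n) ` (B\<inverse> `` {cornerR n})"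
      "(glue n A B C)\<inverse> `` {cornerT (Suc n)} = (+) (cornerT n) ` (C\<inverse> `` {cornerT n})"
    unfolding converse_glue corner_Suc
    by (simp_all only: glue_Image_L[OF sub] glue_Image_R[OF sub] glue_Image_T[OF sub] corners_in_sg_verts
        corners_distinct corners_distinct[symmetric] not_False_eq_True)
  \<comment> \<open>The sides double in length, but the arcs of \<open>A\<close> end within
    coordinate sum \<open>2 ^ n\<close>, so the longer sides meet no further neighbours. For the
    other copies, translation matches the sides directly.\<close>
  have L: "sideLT (Suc n) \<inter> A\<inverse> `` {v} = sideLT n \<inter> A\<inverse> `` {v}" "sideLR (Suc n) \<inter> A\<inverse> `` {v} = sideLR n \<inter> A\<inverse> `` {v}" for v
    using subset_sg_adjD(5)[OF sub(1), of v] by (fastforce simp: sideLT_def sideLR_def)+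
  have R: "sideLR (Suc n) \<inter> (+) (cornerR n) ` X = (+) (cornerR n) ` (sideLR n \<inter> X)"
      "sideTR (Suc n) \<inter> (+) (cornerR n) ` X = (+) (cornerR n) ` (sideTR n \<inter> X)" for X
    by (auto simp: sideTR_def sideLR_def cornerR_def)
  have T: "sideLT (Suc n) \<inter> (+) (cornerT n) ` X = (+) (cornerT n) ` (sideLT n \<inter> X)"
      "sideTR (Suc n) \<inter> (+) (cornerT n) ` X = (+) (cornerT n) ` (sideTR n \<inter> X)" for X
    by (auto simp: sideTR_def sideLT_def cornerT_def)
  show ?thesis
    using b unfolding boundary_def edge_in_iff im L R T by simp
qed

text \<open>Two copies meet in one vertex only. A common arc would have both ends there, contrary to
  loop-freeness.\<close>

lemma glue_shift_disjoint:
  "sg_adj n \<inter> map_prod ((+) (cornerR n)) ((+) (cornerR n)) ` sg_adj n = {}"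
  "(sg_adj n \<union> map_prod ((+) (cornerR n)) ((+) (cornerR n)) ` sg_adj n)
    \<inter> map_prod ((+) (cornerT n)) ((+) (cornerT n)) ` sg_adj n = {}"
proof -
  have LR: False if "(cornerR n + u, cornerR n + v) \<in> sg_adj n" "(u, v) \<in> sg_adj n" for u v
    using subset_sg_adjD(3-5)[OF subset_refl that(1)]
    by (cases u; cases v) (auto simp: corner_defs)
  have LT: False if "(cornerT n + u, cornerT n + v) \<in> sg_adj n" "(u, v) \<in> sg_adj n" for u v
    using subset_sg_adjD(3-5)[OF subset_refl that(1)]
    by (cases u; cases v) (auto simp: corner_defs)
  have RT: "map_prod ((+) (cornerR n)) ((+) (cornerR n)) p \<noteq> map_prod ((+) (cornerT n)) ((+) (cornerT n)) q"
    if "p \<in> sg_adj n" for p q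
  proof -
    obtain u v where p: "p = (u, v)"
      by (cases p)
    then show ?thesis
      using subset_sg_adjD(3-5)[OF subset_refl that[unfolded p]]
      by (cases u; cases v; cases q) (auto simp: corner_defs)
  qed
  show "sg_adj n \<inter> map_prod ((+) (cornerR n)) ((+) (cornerR n)) ` sg_adj n = {}"
    using LR by (auto simp del: mem_adjacency)
  have "sg_adj n \<inter> map_prod ((+) (cornerT n)) ((+) (cornerT n)) ` sg_adj n = {}"
    using LT by (auto simp del: mem_adjacency)
  moreover have "map_prod ((+) (cornerR n)) ((+) (cornerR n)) ` sg_adj n
      \<inter> map_prod ((+) (cornerT n)) ((+) (cornerT n)) ` sg_adj n = {}"
    by (intro equals0I, elim IntE imageE) (metis RT)
  ultimately show "(sg_adj n \<union> map_prod ((+) (cornerR n)) ((+) (cornerR n)) ` sg_adj n)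
      \<inter> map_prod ((+) (cornerT n)) ((+) (cornerT n)) ` sg_adj n = {}"
    by (simp only: Int_Un_distrib2 Un_empty_left)
qed

text \<open>Composes three bijections: translate the second and third orientation, unite the first
  two, then unite the result with the third.\<close>

lemma bij_betw_glue:
  "bij_betw (\<lambda>((A, B), C). glue n A B C)
    ((orientations (sg_edges n) \<times> orientations (sg_edges n)) \<times> orientations (sg_edges n))
    (orientations (sg_edges (Suc n)))"
proof -
  let ?O = "orientations (sg_edges n)" and ?R = "(+) (cornerR n)" and ?T = "(+) (cornerT n)"
  let ?ER = "(`) ?R ` sg_edges n" and ?ET = "(`) ?T ` sg_edges n"
  note [trans] = bij_betw_trans
  have "bij_betw (map_prod (map_prod id ((`) (map_prod ?R ?R))) ((`) (map_prod ?T ?T)))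
      ((?O \<times> ?O) \<times> ?O) ((?O \<times> orientations ?ER) \<times> orientations ?ET)"
    by (intro bij_betw_map_prod bij_betw_orientations_image inj_plus_point bij_betw_id)
  also have "bij_betw (map_prod (\<lambda>(A, B). A \<union> B) id)
      ((?O \<times> orientations ?ER) \<times> orientations ?ET) (orientations (sg_edges n \<union> ?ER) \<times> orientations ?ET)"
    by (intro bij_betw_map_prod bij_betw_orientations_Un bij_betw_id)
      (simp only: adjacency_image[OF inj_plus_point] glue_shift_disjoint)
  also have "bij_betw (\<lambda>(A, B). A \<union> B)
      (orientations (sg_edges n \<union> ?ER) \<times> orientations ?ET) (orientations (sg_edges (Suc n)))"
    unfolding sg_edges.simps
    by (intro bij_betw_orientations_Un)
      (simp only: adjacency_Un adjacency_image[OF inj_plus_point] glue_shift_disjoint)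
  finally show ?thesis
    by (rule bij_betw_cong[THEN iffD1, rotated]) (auto simp: glue_def)
qed

section \<open>Recursion for the boundary counts\<close>

lemma finite_ice_configs: "finite (ice_configs n)"
proof (rule finite_subset)
  show "ice_configs n \<subseteq> Pow (sg_adj n)"
    using orientations_subset by (auto simp: ice_configs_def simp del: mem_adjacency)
  have "sg_adj n \<subseteq> sg_verts n \<times> sg_verts n"
    using sg_adj_verts by (intro subrelI) blast
  then show "finite (Pow (sg_adj n))"
    using finite_sg_verts finite_subset by blast
qed

definition boundary_num :: "nat \<Rightarrow> bool \<Rightarrow> bool \<Rightarrow> bool \<Rightarrow> bool \<Rightarrow> bool \<Rightarrow> bool \<Rightarrow> nat" where
  "boundary_num n la lb ra rb ta tb = card {D \<in> ice_configs n. boundary n D = (la, lb, ra, rb, ta, tb)}"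

lemma boundary_num_Suc:
  "boundary_num (Suc n) la lb ra rb ta tb = glue_count (boundary_num n) la lb ra rb ta tb"
proof -
  let ?O = "orientations (sg_edges n)" and ?I = "balanced \<times> balanced \<times> balanced"
  let ?g = "\<lambda>((A, B), C). glue n A B C"
  define X where "X l = {D \<in> ice_configs n. boundary n D = l}" for l
  define Y where "Y = {G \<in> ice_configs (Suc n). boundary (Suc n) G = (la, lb, ra, rb, ta, tb)}"
  \<comment> \<open>\<open>Z i\<close> holds the triples of configurations with the outer bits fixed
    and the shared bits given by \<open>i\<close>; \<open>idx\<close> recovers \<open>i\<close> from
    the triple, which makes the sets \<open>Z i\<close> disjoint.\<close>
  define Z where "Z = (\<lambda>((p1, p2, p3, p4), (q1, q2, q3, q4), (s1, s2, s3, s4)).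
    (X (la, lb, p1, p2, s1, s2) \<times> X (p3, p4, ra, rb, q1, q2)) \<times> X (s3, s4, q3, q4, ta, tb))"
  define idx where "idx = (\<lambda>((A, B), C). case (boundary n A, boundary n B, boundary n C) of
    ((a1, a2, a3, a4, a5, a6), (b1, b2, b3, b4, b5, b6), (c1, c2, c3, c4, c5, c6)) \<Rightarrow>
      ((a3, a4, b1, b2), (b5, b6, c3, c4), (a5, a6, c1, c2)))"
  have idx: "i = idx x" if "x \<in> Z i" for i x
  proof -
    obtain p1 p2 p3 p4 q1 q2 q3 q4 s1 s2 s3 s4 where i: "i = ((p1, p2, p3, p4), (q1, q2, q3, q4), (s1, s2, s3, s4))"
      by (metis prod.exhaust)
    then show ?thesis
      using that by (auto simp: Z_def X_def idx_def)
  qed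
  have mem: "?g x \<in> Y \<longleftrightarrow> x \<in> (\<Union>i\<in>?I. Z i)" if x: "x \<in> (?O \<times> ?O) \<times> ?O" for x
  proof -
    obtain A B C where x_eq: "x = ((A, B), C)"
      by (metis prod.exhaust)
    obtain a1 a2 a3 a4 a5 a6 where a: "boundary n A = (a1, a2, a3, a4, a5, a6)"
      by (rule prod_cases6)
    obtain b1 b2 b3 b4 b5 b6 where b: "boundary n B = (b1, b2, b3, b4, b5, b6)"
      by (rule prod_cases6)
    obtain c1 c2 c3 c4 c5 c6 where c: "boundary n C = (c1, c2, c3, c4, c5, c6)"
      by (rule prod_cases6)
    have o: "A \<in> ?O" "B \<in> ?O" "C \<in> ?O"
      using x x_eq by auto
    have "glue n A B C \<in> orientations (sg_edges (Suc n))"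
      using bij_betw_apply[OF bij_betw_glue x] x_eq by simp
    note G = glue_mem_ice_configs_iff[OF o this a b c] boundary_glue[OF o a b c]
    let ?i = "((a3, a4, b1, b2), (b5, b6, c3, c4), (a5, a6, c1, c2))"
    show ?thesis
    proof
      assume "?g x \<in> Y"
      then have "x \<in> Z ?i" "?i \<in> ?I"
        by (simp_all add: x_eq Y_def Z_def X_def G a b c)
      then show "x \<in> (\<Union>i\<in>?I. Z i)"
        by blast
    next
      assume "x \<in> (\<Union>i\<in>?I. Z i)"
      then obtain i where i: "i \<in> ?I" "x \<in> Z i"
        by blast
      moreover from this have "i = ?i"
        using idx[OF i(2)] by (simp add: x_eq idx_def a b c)
      ultimately have "x \<in> Z ?i" "?i \<in> ?I"
        by simp_all
      then show "?g x \<in> Y"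
        by (simp add: x_eq Y_def Z_def X_def G a b c)
    qed
  qed
  \<comment> \<open>By \<open>mem\<close>, the gluing bijection on all orientations restricts to the
    configurations with the required boundary.\<close>
  have "bij_betw ?g (\<Union>i\<in>?I. Z i) Y"
  proof (rule bij_betw_subset[OF bij_betw_glue])
    show sub: "(\<Union>i\<in>?I. Z i) \<subseteq> (?O \<times> ?O) \<times> ?O"
      unfolding Z_def X_def by (auto simp: ice_configs_iff)
    show "?g ` (\<Union>i\<in>?I. Z i) = Y"
    proof (intro subset_antisym image_subsetI subsetI)
      fix x assume x: "x \<in> (\<Union>i\<in>?I. Z i)"
      show "?g x \<in> Y"
        using iffD2[OF mem[OF subsetD[OF sub x]] x] .
    next
      fix G assume G: "G \<in> Y"
      then have "G \<in> ?g ` ((?O \<times> ?O) \<times> ?O)"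
        unfolding bij_betw_imp_surj_on[OF bij_betw_glue] by (simp add: Y_def ice_configs_iff)
      then obtain x where x: "x \<in> (?O \<times> ?O) \<times> ?O" "G = ?g x"
        by (rule imageE)
      then show "G \<in> ?g ` (\<Union>i\<in>?I. Z i)"
        using iffD1[OF mem[OF x(1)] G[unfolded x(2)]] by (simp only: imageI)
    qed
  qed
  then have "card Y = card (\<Union>i\<in>?I. Z i)"
    by (simp add: bij_betw_same_card)
  also have "\<dots> = (\<Sum>i\<in>?I. card (Z i))"
  proof (rule card_UN_disjoint)
    show "finite ?I"
      by (simp add: balanced_def)
    show "\<forall>i\<in>?I. finite (Z i)"
      by (auto simp: Z_def X_def finite_ice_configs)
    show "\<forall>i\<in>?I. \<forall>j\<in>?I. i \<noteq> j \<longrightarrow> Z i \<inter> Z j = {}"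
      by (intro ballI impI equals0I) (metis IntE idx)
  qed
  also have "\<dots> = glue_count (boundary_num n) la lb ra rb ta tb"
    by (simp add: glue_count_def boundary_num_def Z_def X_def sum.cartesian_product card_cartesian_product split_def)
  finally show ?thesis
    by (simp add: boundary_num_def Y_def)
qed

text \<open>The triangle has no inner vertex, so all eight orientations count. Each edge joins two
  corners and gives opposite bits at its ends; a pattern obeying this occurs once, any other
  never.\<close>

lemma boundary_num_0:
  "boundary_num 0 la lb ra rb ta tb = boundary_count 0 1 0 1 la lb ra rb ta tb"
proof -
  define l r t where lrt: "l = cornerL 0" "r = cornerR 0" "t = cornerT 0"
  have ne: "l \<noteq> r" "l \<noteq> t" "r \<noteq> t" "r \<noteq> l" "t \<noteq> l" "t \<noteq> r"
    by (simp_all add: lrt corner_defs)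
  have edges: "sg_edges 0 = {{l, r}, {r, t}, {l, t}}"
    by (simp add: lrt)
  have adj: "sg_adj 0 = {(l, r), (r, l), (r, t), (t, r), (l, t), (t, l)}"
    unfolding edges by (auto simp: adjacency_def doubleton_eq_iff)
  \<comment> \<open>The parameters are the in-bits \<open>la\<close>, \<open>lb\<close> and
    \<open>rb\<close>, one for each edge of the triangle.\<close>
  define D0 where "D0 x y z = {if x then (t, l) else (l, t), if y then (r, l) else (l, r), if z then (t, r) else (r, t)}"
    for x y z
  have mem_D0: "(t, l) \<in> D0 x y z \<longleftrightarrow> x" "(l, t) \<in> D0 x y z \<longleftrightarrow> \<not> x"
      "(r, l) \<in> D0 x y z \<longleftrightarrow> y" "(l, r) \<in> D0 x y z \<longleftrightarrow> \<not> y"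
      "(t, r) \<in> D0 x y z \<longleftrightarrow> z" "(r, t) \<in> D0 x y z \<longleftrightarrow> \<not> z" for x y z
    using ne by (auto simp: D0_def)
  have D0: "D0 x y z \<in> orientations (sg_edges 0)" for x y z
    unfolding orientations_iff
  proof (intro conjI allI impI)
    show "D0 x y z \<subseteq> sg_adj 0"
      unfolding adj D0_def by simp
    fix u v assume "{u, v} \<in> sg_edges 0"
    then have "(u, v) \<in> sg_adj 0"
      by (simp only: mem_adjacency)
    then show "(u, v) \<in> D0 x y z \<longleftrightarrow> (v, u) \<notin> D0 x y z"
      unfolding adj by (elim insertE) (simp_all add: mem_D0)
  qed
  have eq_D0: "D = D0 ((t, l) \<in> D) ((r, l) \<in> D) ((t, r) \<in> D)" if D: "D \<in> orientations (sg_edges 0)" for D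
  proof -
    have "(u, v) \<in> D \<longleftrightarrow> (v, u) \<notin> D" if "(u, v) \<in> sg_adj 0" for u v
      using D[unfolded orientations_iff, THEN conjunct2, rule_format, of u v] that
      by (simp only: mem_adjacency)
    then have flip: "(l, t) \<in> D \<longleftrightarrow> (t, l) \<notin> D" "(l, r) \<in> D \<longleftrightarrow> (r, l) \<notin> D" "(r, t) \<in> D \<longleftrightarrow> (t, r) \<notin> D"
      unfolding adj by blast+
    have "p \<in> D \<longleftrightarrow> p \<in> D0 ((t, l) \<in> D) ((r, l) \<in> D) ((t, r) \<in> D)" if "p \<in> sg_adj 0" for p
      using that unfolding adj by (elim insertE) (simp_all only: mem_D0 flip simp_thms empty_iff)
    moreover have "D \<subseteq> sg_adj 0" "D0 ((t, l) \<in> D) ((r, l) \<in> D) ((t, r) \<in> D) \<subseteq> sg_adj 0"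
      using D D0 orientations_subset by blast+
    ultimately show ?thesis
      by blast
  qed
  have side: "(0, 1) = t" "(1, 0) = r" "(2 ^ 0 - 1, 0) = l" "(2 ^ 0 - 1, 1) = t" "(1, 2 ^ 0 - 1) = r" "(0, 2 ^ 0 - 1) = l"
    by (simp_all add: lrt corner_defs)
  have bd: "boundary 0 D = ((t, l) \<in> D, (r, l) \<in> D, (l, r) \<in> D, (t, r) \<in> D, (r, t) \<in> D, (l, t) \<in> D)"
    if "D \<in> orientations (sg_edges 0)" for D
    using that[THEN edge_in_orientation_iff, OF sg_adj_cornerL_side(1)]
      that[THEN edge_in_orientation_iff, OF sg_adj_cornerL_side(2)]
      that[THEN edge_in_orientation_iff, OF sg_adj_cornerR_side(1)]
      that[THEN edge_in_orientation_iff, OF sg_adj_cornerR_side(2)]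
      that[THEN edge_in_orientation_iff, OF sg_adj_cornerT_side(1)]
      that[THEN edge_in_orientation_iff, OF sg_adj_cornerT_side(2)]
    unfolding boundary_def side lrt[symmetric] by (simp only:)
  have bd_D0: "boundary 0 (D0 x y z) = (x, y, \<not> y, z, \<not> z, \<not> x)" for x y z
    by (simp only: bd[OF D0] mem_D0)
  have ice: "ice_configs 0 = orientations (sg_edges 0)"
    by (auto simp: ice_configs_iff sg_inner_def simp del: sg_edges.simps)
  have "{D \<in> ice_configs 0. boundary 0 D = (la, lb, ra, rb, ta, tb)} =
      (if ra \<noteq> lb \<and> ta \<noteq> rb \<and> tb \<noteq> la then {D0 la lb rb} else {})" (is "?S = ?T")
  proof (intro subset_antisym subsetI)
    fix D assume "D \<in> ?S"
    then have D: "D \<in> orientations (sg_edges 0)" and "boundary 0 D = (la, lb, ra, rb, ta, tb)"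
      by (auto simp: ice)
    moreover obtain x y z where "D = D0 x y z"
      using eq_D0[OF D] by blast
    ultimately show "D \<in> ?T"
      by (auto simp: bd_D0 simp del: sg_edges.simps)
  next
    fix D assume "D \<in> ?T"
    then have "D = D0 la lb rb" "ra \<noteq> lb \<and> ta \<noteq> rb \<and> tb \<noteq> la"
      by (simp_all split: if_splits)
    then show "D \<in> ?S"
      using D0 by (simp add: ice bd_D0)
  qed
  then have "boundary_num 0 la lb ra rb ta tb = of_bool (ra \<noteq> lb \<and> ta \<noteq> rb \<and> tb \<noteq> la)"
    by (simp add: boundary_num_def)
  then show ?thesis
    by (cases la; cases lb; cases ra; cases rb; cases ta; cases tb) (simp_all add: boundary_count_table)
qed

section \<open>Reading off the four recurrences\<close>

lemma edge_out_corner: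
  assumes "D \<in> ice_configs n"
  shows "edge_out D (cornerL n) (sideLT n) \<longleftrightarrow> \<not> edge_in D (cornerL n) (sideLT n)"
    "edge_out D (cornerL n) (sideLR n) \<longleftrightarrow> \<not> edge_in D (cornerL n) (sideLR n)"
    "edge_out D (cornerR n) (sideLR n) \<longleftrightarrow> \<not> edge_in D (cornerR n) (sideLR n)"
    "edge_out D (cornerR n) (sideTR n) \<longleftrightarrow> \<not> edge_in D (cornerR n) (sideTR n)"
    "edge_out D (cornerT n) (sideTR n) \<longleftrightarrow> \<not> edge_in D (cornerT n) (sideTR n)"
    "edge_out D (cornerT n) (sideLT n) \<longleftrightarrow> \<not> edge_in D (cornerT n) (sideLT n)"
proof -
  have "D \<in> orientations (sg_edges n)"
    using assms by (simp add: ice_configs_iff)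
  note out = edge_out_orientation_iff[OF this]
  show "edge_out D (cornerL n) (sideLT n) \<longleftrightarrow> \<not> edge_in D (cornerL n) (sideLT n)"
    "edge_out D (cornerL n) (sideLR n) \<longleftrightarrow> \<not> edge_in D (cornerL n) (sideLR n)"
    "edge_out D (cornerR n) (sideLR n) \<longleftrightarrow> \<not> edge_in D (cornerR n) (sideLR n)"
    "edge_out D (cornerR n) (sideTR n) \<longleftrightarrow> \<not> edge_in D (cornerR n) (sideTR n)"
    "edge_out D (cornerT n) (sideTR n) \<longleftrightarrow> \<not> edge_in D (cornerT n) (sideTR n)"
    "edge_out D (cornerT n) (sideLT n) \<longleftrightarrow> \<not> edge_in D (cornerT n) (sideLT n)"
    by (rule out sg_adj_cornerL_side sg_adj_cornerR_side sg_adj_cornerT_side)+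
qed

lemma prescribed_counts:
  "pa n = boundary_num n False False True True True False"
  "pb n = boundary_num n False False True True False True"
  "pc n = boundary_num n False True False True True False"
  "pd n = boundary_num n False True False True False True"
  unfolding pa_def pb_def pc_def pd_def boundary_num_def boundary_def
  by (auto simp: edge_out_corner intro!: arg_cong[where f = card])

text \<open>Induction only yields some parameters \<open>a\<close>, \<open>b\<close>,
  \<open>c\<close>, \<open>d\<close>; evaluating the table at the four prescribed patterns then
  identifies them.\<close>

lemma boundary_num_eq:
  "boundary_num n la lb ra rb ta tb = boundary_count (pa n) (pb n) (pc n) (pd n) la lb ra rb ta tb"
proof -
  have "\<exists>a b c d. boundary_num n = boundary_count a b c d"
  proof (induction n)
    case 0
    show ?case
      using boundary_num_0 by blast
  next
    case (Suc n)
    then obtain a b c d where "boundary_num n = boundary_count a b c d"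
      by blast
    then show ?case
      using boundary_num_Suc[of n] by (metis glue_count_boundary_count ext)
  qed
  then show ?thesis
    by (auto simp: prescribed_counts boundary_count_table)
qed

theorem lemma3p1:
  fixes n :: nat
  shows "pa (n + 1) = (pa n + pb n)\<^sup>2 * (pa n + 3 * pc n + pd n) \<and>
    pb (n + 1) = (pa n + pb n)\<^sup>2 * (pb n + 3 * pc n + pd n) \<and>
    pc (n + 1) = (pa n)\<^sup>2 * pb n + (pb n)\<^sup>2 * pa n + (3 * pc n + pd n) ^ 3 \<and>
    pd (n + 1) = (pa n) ^ 3 + (pb n) ^ 3 + (3 * pc n + pd n) ^ 3"
proof -
  \<comment> \<open>An equation between functions is needed, since \<open>glue_count\<close> sums
    over all values of \<open>boundary_num n\<close>.\<close>
  have "boundary_num n = boundary_count (pa n) (pb n) (pc n) (pd n)"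
    by (intro ext boundary_num_eq)
  then show ?thesis
    by (simp only: Suc_eq_plus1[symmetric] prescribed_counts[of "Suc n"] boundary_num_Suc
        glue_count_boundary_count boundary_count_table simp_thms)
qed

end
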